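(* Suppose that $f$ satisfies the following three conditions: (i) $f$ is circular on the language of $f^{\omega}(\alpha)$; (ii) the set $f(A)$ is a suffix code, i.e., no image of a letter is a suffix of the image of another letter; (iii) every letter $a\in A$ is growing, i.e., $|f^{n}(a)|\to\infty$ as $n\to\infty$. Let $H\colon \mathcal{S}\to\mathcal{S}$ be the mapping given by $H=T\circ G$. Then $\pi\circ H=T\circ\pi$, and so $\pi\colon(\mathcal{S},H)\to(\mathcal{X},T)$ is a conjugacy.
   Context: $A$ is a finite alphabet and $f\colon A^{*}\to A^{*}$ is a morphism with an iterative fixed point $f^{\omega}(\alpha)=\lim_{n\to\infty}f^{n}(\alpha)$, where $\alpha\in A$ (so $f(\alpha)$ starts with $\alpha$ and $|f^n(\alpha)|\to\infty$). $T$ denotes the shift $(x_n)_{n\ge0}\mapsto(x_{n+1})_{n\ge0}$ on infinite words over any alphabet. $\mathcal{X}\subset A^{\mathbb N}$ is the shift orbit closure of $f^{\omega}(\alpha)$, i.e., the closure of $\{T^k f^\omega(\alpha): k\ge 0\}$. Spaces of infinite words carry the metric $d((x_n),(y_n))=2^{-n}$ with $n=\inf\{n: x_n\ne y_n\}$. $\mathcal{L}(\mathcal{X})$, the language of $\mathcal{X}$ (or of $f^\omega(\alpha)$), is the set of finite factors of $f^{\omega}(\alpha)$. Circularity: $f$ is circular on $\mathcal{L}(\mathcal{X})$ if $f$ is injective on $\mathcal{L}(\mathcal{X})$ and there is $\ell\ge1$ (a synchronization delay) such that every $w\in\mathcal{L}(\mathcal{X})$ with $|w|\ge\ell$ can be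 written $w=w_1w_2$ such that for all $v_1,v_2\in A^{*}$, if $v_1wv_2\in f(\mathcal{L}(\mathcal{X}))$ then $v_1w_1\in f(\mathcal{L}(\mathcal{X}))$ and $w_2v_2\in f(\mathcal{L}(\mathcal{X}))$. $S'$ is the set of nonempty suffixes of the words $f(a)$, $a\in A$; $S=\{0,1,\dots,|S'|-1\}$ is regarded as a finite alphabet, and $c\colon S\to S'$ is a fixed bijection. For $\mathbf{s}=s_0s_1s_2\cdots\in S^{\mathbb N}$ put $\pi(\mathbf{s})=c(s_0)f(c(s_1))f^{2}(c(s_2))\cdots$, and let $\mathcal{S}=\{\mathbf{s}\in S^{\mathbb N}:\pi(\mathbf{s})\in\mathcal{X}\}$. In the statement $\pi$ denotes the restriction $\pi\colon\mathcal{S}\to\mathcal{X}$. The map $G\colon\mathcal{S}\to\mathcal{S}$ is defined as follows. Let $\mathbf{s}=s_0s_1\cdots\in\mathcal{S}$. If there is a smallest $r\ge0$ with $|c(s_r)|\ge2$, write $c(s_r)=au$ with $a\in A$, $u\in A^{+}$; then $G(\mathbf{s})=t_0t_1\cdots$ with $t_i=c^{-1}(f(c(s_i)))$ for $0\le i\le r-1$, $t_r=c^{-1}(f(a))$, $t_{r+1}=c^{-1}(u)$, and $t_i=s_{i-1}$ for $i\ge r+2$. If every $c(s_i)$ is a letter, then $G(\mathbf{s})=t_0t_1\cdots$ with $t_i=c^{-1}(f(c(s_i)))$ for all $i\ge0$. A conjugacy between $(\mathcal{S},H)$ and $(\mathcal{X},T)$ is a homeomorphism intertwining the two maps. That $H$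 maps $\mathcal{S}$ into $\mathcal{S}$ is part of the statement. *)

theory Defs
  imports "HOL-Analysis.Analysis" "HOL-Library.Sublist"
begin

text \<open>Infinite words over an alphabet are functions on \<^typ>\<open>nat\<close>.\<close>

definition shift :: "(nat \<Rightarrow> 'b) \<Rightarrow> nat \<Rightarrow> 'b" where
  "shift x = (\<lambda>n. x (Suc n))"

text \<open>The distance of a word to itself is \<open>0\<close> (the infimum of the empty set being infinite).\<close>

definition word_dist :: "(nat \<Rightarrow> 'b) \<Rightarrow> (nat \<Rightarrow> 'b) \<Rightarrow> real" where
  "word_dist x y = (if x = y then 0 else 1 / 2 ^ (LEAST n. x n \<noteq> y n))"

lemma word_dist_commute: "word_dist x y = word_dist y x"
proof -
  have "(\<lambda>n. x n \<noteq> y n) = (\<lambda>n. y n \<noteq> x n)" by (intro ext) metis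
  moreover have "x = y \<longleftrightarrow> y = x" by metis
  ultimately show ?thesis unfolding word_dist_def by presburger
qed

lemma word_dist_nonneg: "0 \<le> word_dist x y"
  by (simp add: word_dist_def)

lemma word_dist_mono:
  assumes "x n \<noteq> y n"
  shows "1 / 2 ^ n \<le> word_dist x y"
proof -
  have "(LEAST n. x n \<noteq> y n) \<le> n" using assms by (rule Least_le)
  then have "(2::real) ^ (LEAST n. x n \<noteq> y n) \<le> 2 ^ n" by (intro power_increasing) auto
  then have "1 / (2::real) ^ n \<le> 1 / 2 ^ (LEAST n. x n \<noteq> y n)"
    by (intro divide_left_mono) auto
  moreover have "x \<noteq> y" using assms by blast
  ultimately show ?thesis unfolding word_dist_def by presburger
qed

lemma word_dist_triangle: "word_dist x z \<le> word_dist x y + word_dist y z"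
proof (cases "x = z")
  case True
  then show ?thesis using word_dist_nonneg[of x y] word_dist_nonneg[of y z]
    by (simp add: word_dist_def)
next
  case False
  define n where "n = (LEAST n. x n \<noteq> z n)"
  have "\<exists>n. x n \<noteq> z n" using False by blast
  then have "x n \<noteq> z n" unfolding n_def by (rule LeastI_ex)
  moreover have "word_dist x z = 1 / 2 ^ n"
    unfolding word_dist_def n_def using False by presburger
  ultimately show ?thesis
    using word_dist_mono[of x n y] word_dist_mono[of y n z]
      word_dist_nonneg[of x y] word_dist_nonneg[of y z]
    by (cases "x n = y n") auto
qed

lemma Metric_space_word_dist: "Metric_space UNIV word_dist"
proof (rule Metric_space.intro)
  show "word_dist x y = 0 \<longleftrightarrow> x = y" for x y :: "nat \<Rightarrow> 'b"
    by (simp add: word_dist_def)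
qed (rule word_dist_nonneg word_dist_commute word_dist_triangle)+

definition word_topology :: "(nat \<Rightarrow> 'b) topology" where
  "word_topology = Metric_space.mtopology UNIV word_dist"

text \<open>The infinite word that is the limit of a sequence of finite words, each a prefix of the
  next and with unbounded lengths.  It is only used for such sequences.\<close>

definition limit_word :: "(nat \<Rightarrow> 'b list) \<Rightarrow> nat \<Rightarrow> 'b" where
  "limit_word u = (\<lambda>n. u (LEAST k. n < length (u k)) ! n)"

definition factors :: "(nat \<Rightarrow> 'b) \<Rightarrow> 'b list set" where
  "factors x = {map x [i..<i + n] | i n. True}"

definition orbit_closure :: "(nat \<Rightarrow> 'b) \<Rightarrow> (nat \<Rightarrow> 'b) set" where
  "orbit_closure x = word_topology closure_of {(shift ^^ k) x | k. True}"

definition morphism :: "('a list \<Rightarrow> 'a list) \<Rightarrow> bool" where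
  "morphism f \<longleftrightarrow> (\<forall>u v. f (u @ v) = f u @ f v)"

definition growing :: "('a list \<Rightarrow> 'a list) \<Rightarrow> 'a \<Rightarrow> bool" where
  "growing f a \<longleftrightarrow> filterlim (\<lambda>n. length ((f ^^ n) [a])) at_top sequentially"

definition prolongable :: "('a list \<Rightarrow> 'a list) \<Rightarrow> 'a \<Rightarrow> bool" where
  "prolongable f \<alpha> \<longleftrightarrow> prefix [\<alpha>] (f [\<alpha>]) \<and> growing f \<alpha>"

definition fixed_word :: "('a list \<Rightarrow> 'a list) \<Rightarrow> 'a \<Rightarrow> nat \<Rightarrow> 'a" where
  "fixed_word f \<alpha> = limit_word (\<lambda>n. (f ^^ n) [\<alpha>])"

definition circular_on :: "('a list \<Rightarrow> 'a list) \<Rightarrow> 'a list set \<Rightarrow> bool" where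
  "circular_on f L \<longleftrightarrow> inj_on f L \<and>
    (\<exists>l\<ge>1. \<forall>w\<in>L. length w \<ge> l \<longrightarrow>
      (\<exists>w1 w2. w = w1 @ w2 \<and>
        (\<forall>v1 v2. v1 @ w @ v2 \<in> f ` L \<longrightarrow> v1 @ w1 \<in> f ` L \<and> w2 @ v2 \<in> f ` L)))"

text \<open>In particular, distinct letters have distinct images.\<close>

definition suffix_code_images :: "('a list \<Rightarrow> 'a list) \<Rightarrow> bool" where
  "suffix_code_images f \<longleftrightarrow> (\<forall>a b. a \<noteq> b \<longrightarrow> \<not> suffix (f [a]) (f [b]))"

definition image_suffixes :: "('a list \<Rightarrow> 'a list) \<Rightarrow> 'a list set" where
  "image_suffixes f = {u. u \<noteq> [] \<and> (\<exists>a. suffix u (f [a]))}"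

definition suffix_alphabet :: "('a list \<Rightarrow> 'a list) \<Rightarrow> nat set" where
  "suffix_alphabet f = {..<card (image_suffixes f)}"

definition suffix_proj :: "('a list \<Rightarrow> 'a list) \<Rightarrow> (nat \<Rightarrow> 'a list) \<Rightarrow> (nat \<Rightarrow> nat) \<Rightarrow> nat \<Rightarrow> 'a" where
  "suffix_proj f c s = limit_word (\<lambda>n. concat (map (\<lambda>i. (f ^^ i) (c (s i))) [0..<n]))"

definition suffix_space ::
    "('a list \<Rightarrow> 'a list) \<Rightarrow> 'a \<Rightarrow> (nat \<Rightarrow> 'a list) \<Rightarrow> (nat \<Rightarrow> nat) set" where
  "suffix_space f \<alpha> c =
    {s. (\<forall>i. s i \<in> suffix_alphabet f) \<and> suffix_proj f c s \<in> orbit_closure (fixed_word f \<alpha>)}"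

definition G_map :: "('a list \<Rightarrow> 'a list) \<Rightarrow> (nat \<Rightarrow> 'a list) \<Rightarrow> (nat \<Rightarrow> nat) \<Rightarrow> nat \<Rightarrow> nat" where
  "G_map f c s =
    (let c' = inv_into (suffix_alphabet f) c in
     if \<exists>r. length (c (s r)) \<ge> 2 then
       (let r = (LEAST r. length (c (s r)) \<ge> 2) in
        (\<lambda>i. if i < r then c' (f (c (s i)))
             else if i = r then c' (f [hd (c (s r))])
             else if i = r + 1 then c' (tl (c (s r)))
             else s (i - 1)))
     else (\<lambda>i. c' (f (c (s i)))))"

definition H_map :: "('a list \<Rightarrow> 'a list) \<Rightarrow> (nat \<Rightarrow> 'a list) \<Rightarrow> (nat \<Rightarrow> nat) \<Rightarrow> nat \<Rightarrow> nat" where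
  "H_map f c = shift \<circ> G_map f c"

definition conjugacy ::
    "(nat \<Rightarrow> 'b) set \<Rightarrow> ((nat \<Rightarrow> 'b) \<Rightarrow> nat \<Rightarrow> 'b) \<Rightarrow> (nat \<Rightarrow> 'a) set \<Rightarrow> ((nat \<Rightarrow> 'a) \<Rightarrow> nat \<Rightarrow> 'a)
      \<Rightarrow> ((nat \<Rightarrow> 'b) \<Rightarrow> nat \<Rightarrow> 'a) \<Rightarrow> bool" where
  "conjugacy Y g X h p \<longleftrightarrow>
    g \<in> Y \<rightarrow> Y \<and> h \<in> X \<rightarrow> X \<and>
    homeomorphic_map (subtopology word_topology Y) (subtopology word_topology X) p \<and>
    (\<forall>y\<in>Y. p (g y) = h (p y))"

end

theory Submission
  imports Defs "HOL-Library.Omega_Words_Fun"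
begin

text \<open>
  Let \<open>F\<close> be the extension of \<open>f\<close> to infinite words (\<open>inf_image\<close>).  Then
  \<open>\<pi>(s) = c(s\<^sub>0) F(\<pi>(T s))\<close>, so a code word \<open>s\<close> of \<open>x\<close> records how \<open>x\<close> is desubstituted again and
  again: a nonempty suffix \<open>c(s\<^sub>0)\<close> of the image of a letter is removed, and the rest is the image
  of \<open>\<pi>(T s)\<close>.

  The intertwining relation follows from this recursion.  The map \<open>G\<close> is a lift of \<open>F\<close>, that is
  \<open>\<pi> \<circ> G = F \<circ> \<pi>\<close> (\<open>proj_G\<close>): the first entry \<open>a u\<close> with at least two
  letters is replaced by \<open>f(a)\<close> and \<open>u\<close>, and the letters before it by their images.  As the entry at position \<open>i\<close>
  contributes its image under \<open>f\<^sup>i\<close> to \<open>\<pi>(s)\<close>, moving \<open>u\<close> and all later entries to the next position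
  applies \<open>f\<close> to their contributions.
  If \<open>c(s\<^sub>0)\<close> is a letter then \<open>T G(s) = G(T s)\<close>, and \<open>\<pi>(G(T s)) = F(\<pi>(T s))\<close> is \<open>\<pi>(s)\<close> without this
  letter.  If \<open>c(s\<^sub>0)\<close> is longer then \<open>H\<close> only removes its first letter.

  What remains is that \<open>\<pi>\<close> is a homeomorphism.  It is continuous, the space of code words is
  compact and \<open>\<X>\<close> is Hausdorff, so bijectivity is enough.

  Surjectivity: every shift of the fixed word is \<open>u F(y)\<close> with \<open>u\<close> a suffix as above and \<open>y\<close> again a
  shift of the fixed word.  For each of the finitely many \<open>u\<close> the set \<open>{u F(y) | y \<in> \<X>}\<close> is
  compact, so the union of these sets is closed and contains \<open>\<X>\<close> (\<open>desubstitution_exists\<close>).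
  Iterating gives a code word.

  Injectivity: let \<open>x = \<pi>(s) = c(s\<^sub>0) F(y)\<close> with \<open>y = \<pi>(T s)\<close>, and let \<open>x = u' F(y')\<close> with
  \<open>y' \<in> \<X>\<close>.  A priori \<open>y\<close> need not be in \<open>\<X>\<close>, and circularity only speaks of words of the
  language.  But \<open>y\<close> contains, arbitrarily far out, words \<open>f\<^sup>j(a)\<close> of the language with \<open>j\<close> large
  (\<open>deep_blocks\<close>; here the letters must be growing).  The image of such a word is long, so
  circularity provides a position in it that is a boundary between images of letters in both
  factorizations (\<open>common_cuts\<close>).  Up to a common boundary the two factorizations can be read from
  right to left, and for a suffix code this is deterministic (\<open>suffix_code_unique\<close>).  As common
  boundaries occur arbitrarily far out, \<open>c(s\<^sub>0) = u'\<close> and \<open>y = y'\<close> (\<open>desubstitution_unique\<close>).  In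
  particular \<open>T s\<close> is a code word of a word in \<open>\<X>\<close>, and induction determines all of \<open>s\<close>.

  Notation: \<open>prefix n x\<close> and \<open>suffix n x\<close> are the first \<open>n\<close> letters and the \<open>n\<close>-th shift of an infinite
  word, \<open>u \<frown> x\<close> is concatenation; the prefix and suffix orders on lists are written with the
  qualifier \<open>Sublist\<close>.
\<close>

section \<open>Infinite concatenations\<close>

lemma limit_word_nth:
  assumes chain: "\<And>k. Sublist.prefix (u k) (u (Suc k))" and i: "i < length (u k)"
  shows "limit_word u i = u k ! i"
proof -
  have mono: "Sublist.prefix (u m) (u n)" if "m \<le> n" for m n
    using that by (induction n rule: dec_induct) (auto intro: chain prefix_order.trans)
  define m where "m = (LEAST k. i < length (u k))"
  have "i < length (u m)" unfolding m_def using i by (rule LeastI)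
  moreover have "m \<le> k" unfolding m_def using i by (rule Least_le)
  ultimately show ?thesis
    unfolding limit_word_def m_def[symmetric]
    using mono[of m k] by (auto simp: prefix_def nth_append)
qed

lemma prefix_eq_iff: "prefix n x = prefix n y \<longleftrightarrow> (\<forall>i<n. x i = y i)"
  by (auto simp: subsequence_def)

lemma shift_eq_suffix: "shift x = suffix 1 x"
  by (auto simp: shift_def)

lemma shift_pow_eq_suffix: "(shift ^^ k) x = suffix k x"
  by (induction k) (auto simp: shift_eq_suffix)

lemma shift_conc: "u \<noteq> [] \<Longrightarrow> shift (u \<frown> x) = tl u \<frown> x"
  by (cases u) (auto simp: shift_def)

definition inf_concat :: "(nat \<Rightarrow> 'b list) \<Rightarrow> nat \<Rightarrow> 'b" where
  "inf_concat W = limit_word (\<lambda>n. concat (map W [0..<n]))"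

lemma length_concat_nonempty:
  assumes "\<And>i. W i \<noteq> []"
  shows "n \<le> length (concat (map W [0..<n]))"
proof (induction n)
  case (Suc n)
  then show ?case using assms[of n] by (cases "W n") auto
qed simp

lemma inf_concat_nth:
  assumes "i < length (concat (map W [0..<k]))"
  shows "inf_concat W i = concat (map W [0..<k]) ! i"
  unfolding inf_concat_def
  by (rule limit_word_nth[where u = "\<lambda>n. concat (map W [0..<n])"]) (use assms in auto)

text \<open>
  The coinduction principle for infinite concatenations: repeatedly splitting off \<open>W n\<close> determines
  the word, because the \<open>W n\<close> are nonempty and hence every position is reached.
\<close>
lemma inf_concat_eqI:
  assumes "\<And>i. W i \<noteq> []" and step: "\<And>n. Z n = W n \<frown> Z (Suc n)"
  shows "Z 0 = inf_concat W"
proof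
  fix i
  have split: "Z 0 = concat (map W [0..<n]) \<frown> Z n" for n
  proof (induction n)
    case (Suc n)
    have "concat (map W [0..<Suc n]) \<frown> Z (Suc n) = concat (map W [0..<n]) \<frown> (W n \<frown> Z (Suc n))"
      by simp
    then show ?case by (simp only: Suc step[of n, symmetric])
  qed simp
  have "i < length (concat (map W [0..<Suc i]))"
    using length_concat_nonempty[of W "Suc i", OF assms(1)] by linarith
  then show "Z 0 i = inf_concat W i"
    using split[of "Suc i"] inf_concat_nth by (metis conc_fst)
qed

lemma concat_map_upt_Suc:
  "concat (map W [0..<Suc n]) = W 0 @ concat (map (\<lambda>i. W (Suc i)) [0..<n])"
  by (simp only: upt_conv_Cons[OF zero_less_Suc] map_Suc_upt[symmetric]) (simp add: comp_def)

lemma inf_concat_Suc: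
  assumes "\<And>i. W i \<noteq> []"
  shows "inf_concat W = W 0 \<frown> inf_concat (\<lambda>i. W (Suc i))"
proof
  fix i
  let ?V = "\<lambda>i. W (Suc i)"
  have "i < length (concat (map ?V [0..<Suc i]))"
    using length_concat_nonempty[of ?V "Suc i", OF assms] by linarith
  moreover from this have "i < length (concat (map W [0..<Suc (Suc i)]))"
    by (simp only: concat_map_upt_Suc[of W]) simp
  ultimately show "inf_concat W i = (W 0 \<frown> inf_concat ?V) i"
    using inf_concat_nth[of i W "Suc (Suc i)"] inf_concat_nth[of "i - length (W 0)" ?V "Suc i"]
    by (auto simp: conc_def nth_append concat_map_upt_Suc[of W] simp del: upt_Suc)
qed

lemma inf_concat_split:
  assumes "\<And>i. W i \<noteq> []"
  shows "inf_concat W = concat (map W [0..<n]) \<frown> inf_concat (\<lambda>i. W (n + i))"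
proof (induction n)
  case (Suc n)
  then show ?case using inf_concat_Suc[of "\<lambda>i. W (n + i)"] assms by simp
qed simp

text \<open>
  As every \<open>W i\<close> has length at least one, the first \<open>n\<close> letters depend on \<open>W 0, \<dots>, W (n - 1)\<close> only.
  This modulus of continuity is the one of \<open>F\<close> and of \<open>\<pi>\<close>.
\<close>
lemma inf_concat_cong_prefix:
  assumes "\<And>i. W i \<noteq> []" and "\<And>i. V i \<noteq> []" and "\<And>i. i < n \<Longrightarrow> W i = V i"
  shows "prefix n (inf_concat W) = prefix n (inf_concat V)"
proof -
  have "map W [0..<n] = map V [0..<n]" using assms(3) by simp
  then show ?thesis
    unfolding prefix_eq_iff
    using inf_concat_nth[of _ W n] inf_concat_nth[of _ V n] length_concat_nonempty[of W n, OF assms(1)]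
    by (metis order_less_le_trans)
qed

section \<open>The topology of infinite words\<close>

text \<open>Balls of radius \<open>2\<^sup>-\<^sup>n\<close> are cylinders: they fix the first \<open>n + 1\<close> letters.\<close>
lemma openin_word_topology:
  "openin word_topology U \<longleftrightarrow> (\<forall>x\<in>U. \<exists>n. \<forall>y. prefix n y = prefix n x \<longrightarrow> y \<in> U)"
proof -
  interpret Metric_space UNIV "word_dist :: (nat \<Rightarrow> 'a) \<Rightarrow> _" by (rule Metric_space_word_dist)
  have ball: "word_dist x y < 1 / 2 ^ n \<longleftrightarrow> prefix (Suc n) y = prefix (Suc n) x"
    for x y :: "nat \<Rightarrow> 'a" and n
  proof
    assume d: "word_dist x y < 1 / 2 ^ n"
    have "x i = y i" if "i < Suc n" for i
    proof (rule ccontr)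
      assume "x i \<noteq> y i"
      then have "1 / 2 ^ i \<le> word_dist x y" by (rule word_dist_mono)
      moreover have "1 / (2::real) ^ n \<le> 1 / 2 ^ i"
        using that by (intro divide_left_mono power_increasing) auto
      ultimately show False using d by linarith
    qed
    then show "prefix (Suc n) y = prefix (Suc n) x" by (simp only: prefix_eq_iff) metis
  next
    assume eq: "prefix (Suc n) y = prefix (Suc n) x"
    show "word_dist x y < 1 / 2 ^ n"
    proof (cases "x = y")
      case False
      define m where "m = (LEAST i. x i \<noteq> y i)"
      have "\<exists>i. x i \<noteq> y i" using False by blast
      then have "x m \<noteq> y m" unfolding m_def by (rule LeastI_ex)
      then have "n < m" using eq unfolding prefix_eq_iff by (metis not_less_eq)
      then have "(2::real) ^ n < 2 ^ m" by simp
      then show ?thesis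
        using False unfolding word_dist_def m_def[symmetric] by (simp add: divide_strict_left_mono)
    qed (simp add: word_dist_def)
  qed
  show ?thesis
    unfolding word_topology_def openin_mtopology
  proof (intro iffI conjI ballI allI impI subset_UNIV)
    fix x assume "U \<subseteq> UNIV \<and> (\<forall>x. x \<in> U \<longrightarrow> (\<exists>r>0. mball x r \<subseteq> U))" "x \<in> U"
    then obtain r where r: "r > 0" "mball x r \<subseteq> U" by blast
    then obtain n where "(1 / 2 :: real) ^ n < r" using real_arch_pow_inv[of r "1/2"] by auto
    then have "y \<in> U" if "prefix (Suc n) y = prefix (Suc n) x" for y
      using that r(2) ball[of x y n] by (auto simp: power_divide in_mball)
    then show "\<exists>n. \<forall>y. prefix n y = prefix n x \<longrightarrow> y \<in> U" by blast
  next
    fix x assume *: "\<forall>x\<in>U. \<exists>n. \<forall>y. prefix n y = prefix n x \<longrightarrow> y \<in> U" and "x \<in> U"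
    then obtain n where n: "\<And>y. prefix n y = prefix n x \<Longrightarrow> y \<in> U" by blast
    have "mball x (1 / 2 ^ n) \<subseteq> U"
    proof
      fix y assume "y \<in> mball x (1 / 2 ^ n)"
      then have "prefix (Suc n) y = prefix (Suc n) x" by (simp only: ball in_mball)
      then have "prefix n y = prefix n x" by (simp only: prefix_eq_iff) simp
      then show "y \<in> U" by (rule n)
    qed
    then show "\<exists>r>0. mball x r \<subseteq> U" by (intro exI[of _ "1 / 2 ^ n"]) auto
  qed
qed

lemma topspace_word_topology [simp]: "topspace word_topology = UNIV"
  unfolding word_topology_def
  by (rule Metric_space.topspace_mtopology[OF Metric_space_word_dist])

lemma Hausdorff_word_topology: "Hausdorff_space word_topology"
  unfolding word_topology_def
  by (rule Metric_space.Hausdorff_space_mtopology[OF Metric_space_word_dist])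

text \<open>This makes Tychonoff's theorem available for words over a finite alphabet.\<close>
lemma word_topology_eq_product:
  "word_topology = product_topology (\<lambda>_. discrete_topology UNIV) UNIV"
  unfolding topology_eq
proof (intro allI iffI)
  fix U :: "(nat \<Rightarrow> 'a) set"
  assume U: "openin word_topology U"
  show "openin (product_topology (\<lambda>_. discrete_topology UNIV) UNIV) U"
    unfolding openin_product_topology_alt
  proof (intro ballI)
    fix x assume "x \<in> U"
    then obtain n where n: "\<And>y. prefix n y = prefix n x \<Longrightarrow> y \<in> U"
      using U unfolding openin_word_topology by blast
    let ?V = "\<lambda>i. if i < n then {x i} else UNIV"
    have "Pi\<^sub>E UNIV ?V \<subseteq> U"
    proof
      fix y assume y: "y \<in> Pi\<^sub>E UNIV ?V"
      have "y i = x i" if "i < n" for i using PiE_mem[OF y, of i] that by simp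
      then show "y \<in> U" by (intro n) (simp only: prefix_eq_iff, blast)
    qed
    moreover have "finite {i. ?V i \<noteq> UNIV}" by (rule finite_subset[of _ "{..<n}"]) auto
    ultimately show "\<exists>V. finite {i \<in> UNIV. V i \<noteq> topspace (discrete_topology UNIV)} \<and>
        (\<forall>i\<in>UNIV. openin (discrete_topology UNIV) (V i)) \<and> x \<in> Pi\<^sub>E UNIV V \<and> Pi\<^sub>E UNIV V \<subseteq> U"
      by (intro exI[of _ ?V]) auto
  qed
next
  fix U :: "(nat \<Rightarrow> 'a) set"
  assume U: "openin (product_topology (\<lambda>_. discrete_topology UNIV) UNIV) U"
  show "openin word_topology U"
    unfolding openin_word_topology
  proof
    fix x assume "x \<in> U"
    then obtain V where V: "finite {i. V i \<noteq> UNIV}" "x \<in> Pi\<^sub>E UNIV V" "Pi\<^sub>E UNIV V \<subseteq> U"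
      using U unfolding openin_product_topology_alt by auto
    obtain n where n: "\<And>i. V i \<noteq> UNIV \<Longrightarrow> i < n"
      using V(1) unfolding finite_nat_set_iff_bounded by blast
    have "y \<in> U" if "prefix n y = prefix n x" for y
    proof -
      have "y i \<in> V i" for i
        using that n[of i] V(2) unfolding prefix_eq_iff by (cases "V i = UNIV") (auto simp: PiE_iff)
      then show ?thesis using V(3) by auto
    qed
    then show "\<exists>n. \<forall>y. prefix n y = prefix n x \<longrightarrow> y \<in> U" by blast
  qed
qed

lemma compactin_words_over:
  assumes "finite F"
  shows "compactin word_topology {x. \<forall>i. x i \<in> F}"
proof -
  have "{x. \<forall>i. x i \<in> F} = Pi\<^sub>E UNIV (\<lambda>_::nat. F)" by (auto simp: PiE_iff)
  then show ?thesis
    unfolding word_topology_eq_product using assms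
    by (simp add: compactin_PiE compactin_discrete_topology)
qed

lemma continuous_map_wordI:
  fixes g :: "(nat \<Rightarrow> 'b) \<Rightarrow> nat \<Rightarrow> 'c"
  assumes "\<And>n. \<exists>m. \<forall>x\<in>Y. \<forall>y\<in>Y. prefix m y = prefix m x \<longrightarrow> prefix n (g y) = prefix n (g x)"
  shows "continuous_map (subtopology word_topology Y) word_topology g"
  unfolding continuous_map
proof (intro conjI allI impI)
  fix U :: "(nat \<Rightarrow> 'c) set"
  assume U: "openin word_topology U"
  let ?V = "{x. \<exists>m. \<forall>y\<in>Y. prefix m y = prefix m x \<longrightarrow> g y \<in> U}"
  have "openin word_topology ?V"
    unfolding openin_word_topology
  proof
    fix x assume "x \<in> ?V"
    then obtain m where "\<forall>y\<in>Y. prefix m y = prefix m x \<longrightarrow> g y \<in> U" by blast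
    then have "y \<in> ?V" if "prefix m y = prefix m x" for y
      using that by (intro CollectI exI[of _ m]) simp
    then show "\<exists>n. \<forall>y. prefix n y = prefix n x \<longrightarrow> y \<in> ?V" by blast
  qed
  moreover have "{x \<in> Y. g x \<in> U} = Y \<inter> ?V"
  proof (intro equalityI subsetI)
    fix x assume "x \<in> {x \<in> Y. g x \<in> U}"
    then have x: "x \<in> Y" "g x \<in> U" by auto
    then obtain n where n: "\<And>z. prefix n z = prefix n (g x) \<Longrightarrow> z \<in> U"
      using U unfolding openin_word_topology by blast
    obtain m where "\<forall>x\<in>Y. \<forall>y\<in>Y. prefix m y = prefix m x \<longrightarrow> prefix n (g y) = prefix n (g x)"
      using assms by blast
    then show "x \<in> Y \<inter> ?V" using x n by blast
  qed auto
  ultimately show "openin (subtopology word_topology Y)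
      {x \<in> topspace (subtopology word_topology Y). g x \<in> U}"
    by (auto simp: openin_subtopology)
qed auto

section \<open>Factors and orbit closures\<close>

lemma factors_iff: "v \<in> factors x \<longleftrightarrow> (\<exists>u z. x = (u @ v) \<frown> z)"
proof
  assume "v \<in> factors x"
  then obtain i n where v: "v = subsequence x i (i + n)"
    by (auto simp: factors_def subsequence_def)
  then have "x = (prefix i x @ v) \<frown> suffix (i + n) x"
    by (simp only: subsequence_append[symmetric] prefix_suffix[symmetric])
  then show "\<exists>u z. x = (u @ v) \<frown> z" by blast
next
  assume "\<exists>u z. x = (u @ v) \<frown> z"
  then obtain u z where x: "x = (u @ v) \<frown> z" by blast
  have "v = map x [length u..<length u + length v]"
    by (rule nth_equalityI) (auto simp: x nth_append)
  then show "v \<in> factors x" unfolding factors_def by blast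
qed

lemma factors_factor:
  assumes "u @ v @ w \<in> factors x"
  shows "v \<in> factors x"
proof -
  obtain u' z where "x = (u' @ u @ v @ w) \<frown> z" using assms unfolding factors_iff by blast
  then have "x = ((u' @ u) @ v) \<frown> (w \<frown> z)" by simp
  then show ?thesis unfolding factors_iff by blast
qed

lemma openin_cylinder: "openin word_topology {y. prefix n y = prefix n x}"
  unfolding openin_word_topology by (auto intro!: exI[of _ n])

text \<open>
  Membership in an orbit closure becomes a property of finite words, which is the form in which
  circularity can be applied to it.
\<close>
lemma orbit_closure_iff: "x \<in> orbit_closure w \<longleftrightarrow> (\<forall>n. prefix n x \<in> factors w)"
proof
  assume x: "x \<in> orbit_closure w"
  show "\<forall>n. prefix n x \<in> factors w"
  proof
    fix n
    have "\<exists>y. y \<in> {(shift ^^ k) w |k. True} \<and> y \<in> {y. prefix n y = prefix n x}"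
      by (rule x[unfolded orbit_closure_def in_closure_of, THEN conjunct2, THEN spec, THEN mp])
        (simp add: openin_cylinder)
    then obtain k where "prefix n (suffix k w) = prefix n x"
      unfolding shift_pow_eq_suffix by blast
    then have "prefix n x = map w [k..<k + n]"
      unfolding subsequence_shift by (simp add: subsequence_def)
    then show "prefix n x \<in> factors w" unfolding factors_def by blast
  qed
next
  assume x: "\<forall>n. prefix n x \<in> factors w"
  show "x \<in> orbit_closure w"
    unfolding orbit_closure_def in_closure_of
  proof (intro conjI allI impI)
    fix U assume "x \<in> U \<and> openin word_topology U"
    then obtain n where n: "\<And>y. prefix n y = prefix n x \<Longrightarrow> y \<in> U"
      unfolding openin_word_topology by blast
    obtain k m where k: "prefix n x = map w [k..<k + m]"
      using x unfolding factors_def by blast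
    from arg_cong[OF k, of length] have "m = n" by simp
    with k have "prefix n (suffix k w) = prefix n x"
      unfolding subsequence_shift by (simp add: subsequence_def)
    then show "\<exists>y. y \<in> {(shift ^^ k) w |k. True} \<and> y \<in> U"
      using n by (intro exI[of _ "suffix k w"]) (auto simp flip: shift_pow_eq_suffix)
  qed simp
qed

lemma factors_orbit_closure:
  assumes "x \<in> orbit_closure w"
  shows "factors x \<subseteq> factors w"
proof
  fix v assume "v \<in> factors x"
  then obtain u z where x: "x = (u @ v) \<frown> z" unfolding factors_iff by blast
  have "prefix (length (u @ v)) x \<in> factors w" using assms unfolding orbit_closure_iff by blast
  then have "u @ v @ [] \<in> factors w" unfolding x prefix_conc_length by simp
  then show "v \<in> factors w" by (rule factors_factor)
qed

lemma shift_orbit_closure: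
  assumes "x \<in> orbit_closure w"
  shows "shift x \<in> orbit_closure w"
  unfolding orbit_closure_iff
proof
  fix n
  have "(prefix 1 x @ prefix n (shift x)) \<frown> suffix n (shift x) = x"
    by (simp only: conc_conc[symmetric] prefix_suffix[symmetric] shift_eq_suffix)
  then show "prefix n (shift x) \<in> factors w"
    using factors_orbit_closure[OF assms] unfolding factors_iff[of _ x] subset_iff by metis
qed

lemma shift_pow_in_orbit_closure: "(shift ^^ k) w \<in> orbit_closure w"
proof (induction k)
  case 0
  have "prefix n w \<in> factors w" for n
    unfolding factors_iff by (intro exI[of _ "[]"] exI[of _ "suffix n w"]) simp
  then show ?case by (simp add: orbit_closure_iff)
qed (simp add: shift_orbit_closure)

lemma closedin_orbit_closure: "closedin word_topology (orbit_closure w)"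
  unfolding orbit_closure_def by (rule closedin_closure_of)

lemma compactin_orbit_closure:
  fixes w :: "nat \<Rightarrow> 'a::finite"
  shows "compactin word_topology (orbit_closure w)"
  using closed_compactin[OF compactin_words_over[of "UNIV :: 'a set"] _ closedin_orbit_closure]
  by simp

section \<open>Images of infinite words under a morphism\<close>

locale nonerasing_morphism =
  fixes f :: "'a list \<Rightarrow> 'a list"
  assumes hom_append: "f (u @ v) = f u @ f v" and nonerasing: "f [a] \<noteq> []"
begin

lemma hom_Nil [simp]: "f [] = []"
  using hom_append[of "[]" "[]"] by simp

lemma hom_Cons: "f (a # u) = f [a] @ f u"
  using hom_append[of "[a]" u] by simp

lemma hom_eq_Nil_iff [simp]: "f u = [] \<longleftrightarrow> u = []"
proof (cases u)
  case (Cons a v)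
  then show ?thesis using hom_Cons[of a v] nonerasing[of a] by simp
qed simp

lemma length_le_length_hom: "length u \<le> length (f u)"
proof (induction u)
  case (Cons a u)
  then show ?case using nonerasing[of a] by (cases "f [a]") (auto simp: hom_Cons[of a u])
qed simp

lemma nonerasing_morphism_pow: "nonerasing_morphism (f ^^ n)"
proof
  show append_pow: "(f ^^ n) (u @ v) = (f ^^ n) u @ (f ^^ n) v" for u v
    by (induction n) (auto simp: hom_append)
  show "(f ^^ n) [a] \<noteq> []" for a
    by (induction n) auto
qed

definition inf_image :: "(nat \<Rightarrow> 'a) \<Rightarrow> nat \<Rightarrow> 'a" where
  "inf_image y = inf_concat (\<lambda>i. f [y i])"

lemma inf_image_unfold: "inf_image y = f [y 0] \<frown> inf_image (shift y)"
  unfolding inf_image_def shift_def using nonerasing by (subst inf_concat_Suc) auto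

lemma inf_image_conc: "inf_image (u \<frown> y) = f u \<frown> inf_image y"
proof (induction u)
  case (Cons a u)
  have "inf_image (a ## z) = f [a] \<frown> inf_image z" for z
    using inf_image_unfold[of "a ## z"] by (simp add: shift_def)
  then show ?case by (simp add: Cons hom_Cons[of a u])
qed simp

lemma inf_image_inf_concat:
  assumes "\<And>i. W i \<noteq> []"
  shows "inf_image (inf_concat W) = inf_concat (\<lambda>i. f (W i))"
proof -
  let ?Z = "\<lambda>n. inf_image (inf_concat (\<lambda>i. W (n + i)))"
  have "?Z n = f (W n) \<frown> ?Z (Suc n)" for n
    using inf_concat_Suc[of "\<lambda>i. W (n + i)"] assms by (simp add: inf_image_conc)
  then have "?Z 0 = inf_concat (\<lambda>i. f (W i))" by (intro inf_concat_eqI) (auto simp: assms)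
  then show ?thesis by simp
qed

lemma prefix_inf_image_cong:
  assumes "prefix n y = prefix n z"
  shows "prefix n (inf_image y) = prefix n (inf_image z)"
  unfolding inf_image_def
  by (rule inf_concat_cong_prefix) (use assms nonerasing in \<open>auto simp: prefix_eq_iff\<close>)

lemma image_suffixes_map_letter: "f [a] \<in> image_suffixes f"
  by (auto simp: image_suffixes_def nonerasing)

lemma image_suffixes_suffix:
  "v \<in> image_suffixes f \<Longrightarrow> Sublist.suffix u v \<Longrightarrow> u \<noteq> [] \<Longrightarrow> u \<in> image_suffixes f"
  unfolding image_suffixes_def using suffix_order.trans by blast

end

section \<open>The coding by suffixes and the map G\<close>

locale suffix_coding = nonerasing_morphism f for f :: "'a list \<Rightarrow> 'a list" +
  fixes c :: "nat \<Rightarrow> 'a list"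
  assumes bij: "bij_betw c (suffix_alphabet f) (image_suffixes f)"
begin

abbreviation coded :: "(nat \<Rightarrow> nat) set" where
  "coded \<equiv> {s. \<forall>i. s i \<in> suffix_alphabet f}"

lemma finite_image_suffixes: "finite (image_suffixes f)"
  using bij_betw_finite[OF bij] by (simp add: suffix_alphabet_def)

lemma decode: "s \<in> coded \<Longrightarrow> c (s i) \<in> image_suffixes f"
  using bij by (auto simp: bij_betw_def)

lemma decode_nonempty: "s \<in> coded \<Longrightarrow> c (s i) \<noteq> []"
  using decode[of s i] by (simp add: image_suffixes_def)

lemma decode_letter:
  assumes "s \<in> coded" and "\<not> length (c (s i)) \<ge> 2"
  obtains a where "c (s i) = [a]"
proof -
  have "length (c (s i)) = 1"
    using assms(2) decode_nonempty[OF assms(1), of i] unfolding length_0_conv[symmetric] by linarith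
  then show thesis using that by (auto simp: length_Suc_conv)
qed

definition encode :: "'a list \<Rightarrow> nat" where
  "encode = inv_into (suffix_alphabet f) c"

lemma decode_encode: "u \<in> image_suffixes f \<Longrightarrow> c (encode u) = u"
  unfolding encode_def by (metis bij bij_betw_imp_surj_on f_inv_into_f)

lemma encode_in_alphabet: "u \<in> image_suffixes f \<Longrightarrow> encode u \<in> suffix_alphabet f"
  unfolding encode_def by (metis bij bij_betw_imp_surj_on inv_into_into)

lemma decode_inj: "s \<in> coded \<Longrightarrow> t \<in> coded \<Longrightarrow> c (s i) = c (t i) \<Longrightarrow> s i = t i"
  using bij by (auto simp: bij_betw_def inj_on_def)

lemma shift_coded: "s \<in> coded \<Longrightarrow> shift s \<in> coded"
  by (auto simp: shift_def)

abbreviation proj :: "(nat \<Rightarrow> nat) \<Rightarrow> nat \<Rightarrow> 'a" where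
  "proj \<equiv> suffix_proj f c"

lemma proj_eq: "proj s = inf_concat (\<lambda>i. (f ^^ i) (c (s i)))"
  by (simp add: suffix_proj_def inf_concat_def)

lemma block_nonempty: "s \<in> coded \<Longrightarrow> (f ^^ i) (c (s i)) \<noteq> []"
  using nonerasing_morphism.hom_eq_Nil_iff[OF nonerasing_morphism_pow] decode_nonempty by blast

lemma proj_split:
  assumes s: "s \<in> coded"
  shows "proj s = concat (map (\<lambda>i. (f ^^ i) (c (s i))) [0..<n]) \<frown>
    inf_concat (\<lambda>i. (f ^^ (n + i)) (c (s (n + i))))"
  unfolding proj_eq using block_nonempty[OF s] by (rule inf_concat_split)

lemma block_in_factors:
  assumes s: "s \<in> coded"
  shows "(f ^^ n) (c (s n)) \<in> factors (proj s)"
proof -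
  have "proj s = (concat (map (\<lambda>i. (f ^^ i) (c (s i))) [0..<n]) @ (f ^^ n) (c (s n))) \<frown>
      inf_concat (\<lambda>i. (f ^^ (Suc n + i)) (c (s (Suc n + i))))"
    using proj_split[OF s, of "Suc n"] by simp
  then show ?thesis unfolding factors_iff by blast
qed

text \<open>
  The recursion behind the whole proof: a code word describes one desubstitution step, followed by
  the description of the remaining ones.
\<close>
lemma proj_Suc:
  assumes s: "s \<in> coded"
  shows "proj s = c (s 0) \<frown> inf_image (proj (shift s))"
proof -
  have "proj s = c (s 0) \<frown> inf_concat (\<lambda>i. (f ^^ Suc i) (c (s (Suc i))))"
    unfolding proj_eq by (subst inf_concat_Suc) (use block_nonempty[OF s] in auto)
  also have "inf_concat (\<lambda>i. (f ^^ Suc i) (c (s (Suc i)))) = inf_image (proj (shift s))"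
    unfolding proj_eq
    by (subst inf_image_inf_concat) (use block_nonempty[OF shift_coded[OF s]] in \<open>auto simp: shift_def\<close>)
  finally show ?thesis .
qed

lemma prefix_proj_cong:
  assumes "s \<in> coded" "t \<in> coded" "prefix n s = prefix n t"
  shows "prefix n (proj s) = prefix n (proj t)"
  unfolding proj_eq
  by (rule inf_concat_cong_prefix)
    (use assms block_nonempty in \<open>auto simp: prefix_eq_iff\<close>)

lemma G_coded:
  assumes s: "s \<in> coded"
  shows "G_map f c s \<in> coded"
proof -
  have tl: "tl (c (s r)) \<in> image_suffixes f" if "length (c (s r)) \<ge> 2" for r
    using that by (intro image_suffixes_suffix[OF decode[OF s, of r]]) (auto simp: suffix_tl tl_Nil)
  have one: "f (c (s i)) \<in> image_suffixes f" if "\<not> length (c (s i)) \<ge> 2" for i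
  proof -
    obtain a where "c (s i) = [a]" using s \<open>\<not> length (c (s i)) \<ge> 2\<close> by (rule decode_letter)
    then show ?thesis by (simp add: image_suffixes_map_letter)
  qed
  show ?thesis
  proof (cases "\<exists>r. length (c (s r)) \<ge> 2")
    case True
    define r where "r = (LEAST r. length (c (s r)) \<ge> 2)"
    have "length (c (s r)) \<ge> 2" unfolding r_def using True by (rule LeastI_ex)
    moreover have "\<not> length (c (s i)) \<ge> 2" if "i < r" for i
      using that unfolding r_def by (rule not_less_Least)
    ultimately show ?thesis
      using True s unfolding G_map_def Let_def r_def[symmetric] encode_def[symmetric]
      by (auto simp: tl one image_suffixes_map_letter encode_in_alphabet)
  next
    case False
    then show ?thesis
      unfolding G_map_def Let_def encode_def[symmetric] by (auto simp: one encode_in_alphabet)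
  qed
qed

text \<open>
  The only block of \<open>\<pi>(s)\<close> whose image is not a single block of \<open>\<pi>(G(s))\<close> is that of the first long
  entry \<open>a u\<close>, at position \<open>r\<close>: the image of \<open>f\<^sup>r(a u)\<close> is \<open>f\<^sup>r(f(a)) f\<^bsup>r+1\<^esup>(u)\<close>, which fills the
  positions \<open>r\<close> and \<open>r + 1\<close>.
\<close>
lemma proj_G:
  assumes s: "s \<in> coded"
  shows "proj (G_map f c s) = inf_image (proj s)"
proof -
  let ?W = "\<lambda>i. (f ^^ i) (c (s i))" and ?V = "\<lambda>i. (f ^^ i) (c (G_map f c s i))"
  have image: "inf_image (proj s) = inf_concat (\<lambda>i. f (?W i))"
    unfolding proj_eq by (rule inf_image_inf_concat) (rule block_nonempty[OF s])
  have comm: "(f ^^ i) (f u) = f ((f ^^ i) u)" for i u by (induction i) auto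
  have one: "c (encode (f (c (s i)))) = f (c (s i))" if "\<not> length (c (s i)) \<ge> 2" for i
  proof -
    obtain a where "c (s i) = [a]" using s \<open>\<not> length (c (s i)) \<ge> 2\<close> by (rule decode_letter)
    then show ?thesis by (simp add: image_suffixes_map_letter decode_encode)
  qed
  show ?thesis
  proof (cases "\<exists>r. length (c (s r)) \<ge> 2")
    case False
    then have "?V = (\<lambda>i. f (?W i))"
      unfolding G_map_def Let_def encode_def[symmetric] by (auto simp: one comm)
    then show ?thesis unfolding image proj_eq[of "G_map f c s"] by simp
  next
    case True
    define r where "r = (LEAST r. length (c (s r)) \<ge> 2)"
    have r: "length (c (s r)) \<ge> 2" unfolding r_def using True by (rule LeastI_ex)
    then obtain a u where au: "c (s r) = a # u" "u \<noteq> []"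
      by (auto simp: numeral_2_eq_2 Suc_le_length_iff)
    have "u \<in> image_suffixes f"
      using au by (intro image_suffixes_suffix[OF decode[OF s, of r]]) (auto simp: suffix_ConsI)
    then have cu: "c (encode u) = u" by (rule decode_encode)
    have less: "\<not> length (c (s i)) \<ge> 2" if "i < r" for i
      using that unfolding r_def by (rule not_less_Least)
    have G: "G_map f c s = (\<lambda>i. if i < r then encode (f (c (s i))) else if i = r then encode (f [a])
        else if i = r + 1 then encode u else s (i - 1))"
      using True au unfolding G_map_def Let_def r_def[symmetric] encode_def[symmetric] by auto
    have V: "?V i = f (?W i)" if "i < r" for i using that by (simp add: G one less comm)
    have W_r: "f (?W r) = ?V r @ ?V (Suc r)"
      using nonerasing_morphism.hom_Cons[OF nonerasing_morphism_pow, of r a u]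
      by (simp add: G au cu comm hom_append decode_encode image_suffixes_map_letter)
    have tail: "?V (Suc (Suc r) + i) = f (?W (Suc r + i))" for i by (simp add: G)
    have concat_V: "concat (map ?V [0..<Suc (Suc r)]) = concat (map (\<lambda>i. f (?W i)) [0..<Suc r])"
    proof -
      have "map ?V [0..<r] = map (\<lambda>i. f (?W i)) [0..<r]" using V by auto
      then have "concat (map ?V [0..<r]) = concat (map (\<lambda>i. f (?W i)) [0..<r])"
        by (rule arg_cong)
      then show ?thesis using W_r by simp
    qed
    have "proj (G_map f c s) = concat (map (\<lambda>i. f (?W i)) [0..<Suc r]) \<frown> inf_concat (\<lambda>i. f (?W (Suc r + i)))"
      unfolding proj_split[OF G_coded[OF s], of "Suc (Suc r)"] concat_V tail ..
    also have "\<dots> = inf_concat (\<lambda>i. f (?W i))"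
      by (rule inf_concat_split[symmetric]) (use block_nonempty[OF s] in auto)
    finally show ?thesis using image by simp
  qed
qed

lemma G_letter:
  assumes one: "\<not> length (c (s 0)) \<ge> 2"
  shows "shift (G_map f c s) = G_map f c (shift s)"
proof (cases "\<exists>r. length (c (s r)) \<ge> 2")
  case False
  then have "\<not> (\<exists>r. length (c (shift s r)) \<ge> 2)" by (simp add: shift_def)
  with False show ?thesis unfolding G_map_def Let_def by (simp add: shift_def)
next
  case True
  then obtain r where "length (c (s r)) \<ge> 2" by blast
  then have "length (c (shift s (r - 1))) \<ge> 2" using one by (cases r) (auto simp: shift_def)
  then have True': "\<exists>r. length (c (shift s r)) \<ge> 2" by blast
  have "(LEAST r. length (c (s r)) \<ge> 2) = Suc (LEAST r. length (c (shift s r)) \<ge> 2)"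
    unfolding shift_def using one True by (auto intro!: Least_Suc)
  with True True' show ?thesis
    unfolding G_map_def Let_def by (auto simp: shift_def fun_eq_iff)
qed

lemma H_coded: "s \<in> coded \<Longrightarrow> H_map f c s \<in> coded"
  unfolding H_map_def comp_def by (intro shift_coded G_coded)

lemma proj_H:
  assumes s: "s \<in> coded"
  shows "proj (H_map f c s) = shift (proj s)"
proof (cases "length (c (s 0)) \<ge> 2")
  case True
  then have r: "(LEAST r. length (c (s r)) \<ge> 2) = 0" by (intro Least_equality) auto
  have "\<exists>r. length (c (s r)) \<ge> 2" using True by blast
  then have H: "H_map f c s = (\<lambda>i. if i = 0 then encode (tl (c (s 0))) else s i)"
    unfolding H_map_def comp_def G_map_def Let_def r encode_def[symmetric] by (auto simp: shift_def)
  have "tl (c (s 0)) \<in> image_suffixes f"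
    using True by (intro image_suffixes_suffix[OF decode[OF s, of 0]]) (auto simp: suffix_tl tl_Nil)
  then have "c (H_map f c s 0) = tl (c (s 0))" by (simp add: H decode_encode)
  moreover have "shift (H_map f c s) = shift s" by (simp add: H shift_def)
  ultimately have "proj (H_map f c s) = tl (c (s 0)) \<frown> inf_image (proj (shift s))"
    using proj_Suc[OF H_coded[OF s]] by simp
  then show ?thesis by (simp add: proj_Suc[OF s] shift_conc decode_nonempty[OF s])
next
  case False
  obtain a where a: "c (s 0) = [a]" using s False by (rule decode_letter)
  have "proj (H_map f c s) = proj (G_map f c (shift s))"
    unfolding H_map_def comp_def by (simp add: G_letter[of s, OF False])
  also have "\<dots> = inf_image (proj (shift s))" by (rule proj_G[OF shift_coded[OF s]])
  also have "\<dots> = shift (proj s)"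
    unfolding proj_Suc[OF s] by (subst shift_conc) (simp_all add: a)
  finally show ?thesis .
qed

end

section \<open>Desubstitution in the orbit closure\<close>

context nonerasing_morphism
begin

text \<open>Both sides start with \<open>f\<^bsup>k+1\<^esup>(\<alpha>)\<close> for every \<open>k\<close>, the left one because it is the image of a word
  that starts with \<open>f\<^sup>k(\<alpha>)\<close>.\<close>
lemma inf_image_fixed_word:
  assumes "prolongable f \<alpha>"
  shows "inf_image (fixed_word f \<alpha>) = fixed_word f \<alpha>"
proof
  fix i
  let ?u = "\<lambda>k. (f ^^ k) [\<alpha>]" and ?x = "fixed_word f \<alpha>"
  obtain v where v: "f [\<alpha>] = [\<alpha>] @ v"
    using assms by (auto simp: prolongable_def prefix_def)
  have chain: "Sublist.prefix (?u k) (?u (Suc k))" for k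
    unfolding funpow_Suc_right comp_def v
    by (simp only: nonerasing_morphism.hom_append[OF nonerasing_morphism_pow]) simp
  obtain k where k: "Suc i \<le> length (?u k)"
    using assms unfolding prolongable_def growing_def filterlim_at_top eventually_sequentially
    by blast
  have nth: "?x j = ?u n ! j" if "j < length (?u n)" for j n
    unfolding fixed_word_def
    by (rule limit_word_nth[where u = ?u]) (rule chain, rule that)
  have "prefix (length (?u k)) ?x = ?u k"
    by (rule nth_equalityI) (auto simp: nth)
  with prefix_suffix[of ?x "length (?u k)", symmetric]
  have "?u k \<frown> suffix (length (?u k)) ?x = ?x" by (simp only:)
  from arg_cong[OF this[symmetric], of inf_image]
  have "inf_image ?x = ?u (Suc k) \<frown> inf_image (suffix (length (?u k)) ?x)"
    unfolding inf_image_conc by simp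
  moreover have "i < length (?u (Suc k))" using k length_le_length_hom[of "?u k"] by simp
  ultimately show "inf_image ?x i = ?x i" by (simp only: nth conc_fst)
qed

lemma factors_fixed_word_closed:
  assumes "prolongable f \<alpha>" and "w \<in> factors (fixed_word f \<alpha>)"
  shows "(f ^^ n) w \<in> factors (fixed_word f \<alpha>)"
proof (induction n)
  case (Suc n)
  then obtain u z where "fixed_word f \<alpha> = (u @ (f ^^ n) w) \<frown> z" unfolding factors_iff by blast
  from arg_cong[OF this, of inf_image]
  have "fixed_word f \<alpha> = (f u @ (f ^^ Suc n) w) \<frown> inf_image z"
    by (simp add: inf_image_fixed_word[OF assms(1)] inf_image_conc hom_append)
  then show ?case unfolding factors_iff by blast
qed (simp add: assms(2))

text \<open>
  Every position of an image \<open>F(y)\<close> lies in the image of some letter; what is left of that image is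
  the word \<open>u\<close>, and it is nonempty if a position at the end of an image is counted as the start of
  the next one.
\<close>
lemma shift_pow_inf_image:
  "\<exists>u\<in>image_suffixes f. \<exists>j. (shift ^^ k) (inf_image y) = u \<frown> inf_image ((shift ^^ j) y)"
proof (induction k)
  case 0
  have "(shift ^^ 0) (inf_image y) = f [y 0] \<frown> inf_image ((shift ^^ 1) y)"
    using inf_image_unfold[of y] by simp
  then show ?case using image_suffixes_map_letter by blast
next
  case (Suc k)
  then obtain u j where u: "u \<in> image_suffixes f"
      "(shift ^^ k) (inf_image y) = u \<frown> inf_image ((shift ^^ j) y)"
    by blast
  then have "u \<noteq> []" by (simp add: image_suffixes_def)
  then have eq: "(shift ^^ Suc k) (inf_image y) = tl u \<frown> inf_image ((shift ^^ j) y)"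
    using u(2) by (simp add: shift_conc)
  show ?case
  proof (cases "tl u = []")
    case True
    let ?a = "(shift ^^ j) y 0"
    have "(shift ^^ Suc k) (inf_image y) = f [?a] \<frown> inf_image ((shift ^^ Suc j) y)"
      using eq inf_image_unfold[of "(shift ^^ j) y"] by (simp add: True)
    then show ?thesis using image_suffixes_map_letter by blast
  next
    case False
    then have "tl u \<in> image_suffixes f"
      by (intro image_suffixes_suffix[OF u(1)]) (simp add: suffix_tl)
    with eq show ?thesis by blast
  qed
qed

text \<open>
  The closure is taken by compactness: the words of the form \<open>u F(y)\<close> with \<open>y\<close> in the orbit closure
  form a finite union of compact sets, so they include the limits of the shifts of \<open>w\<close>.
\<close>
lemma desubstitution_exists:
  assumes fin: "finite (image_suffixes f)" and fixed: "inf_image w = w"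
    and compact: "compactin word_topology (orbit_closure w)" and x: "x \<in> orbit_closure w"
  shows "\<exists>u\<in>image_suffixes f. \<exists>y\<in>orbit_closure w. x = u \<frown> inf_image y"
proof -
  let ?X = "orbit_closure w"
  let ?K = "\<Union>u\<in>image_suffixes f. (\<lambda>y. u \<frown> inf_image y) ` ?X"
  have "closedin word_topology ((\<lambda>y. u \<frown> inf_image y) ` ?X)" for u
  proof (intro compactin_imp_closedin Hausdorff_word_topology image_compactin[OF compact])
    have "prefix n (u \<frown> inf_image y) = prefix n (u \<frown> inf_image z)" if "prefix n y = prefix n z" for n y z
      using prefix_inf_image_cong[OF that] unfolding prefix_eq_iff by (auto simp: conc_def)
    then show "continuous_map word_topology word_topology (\<lambda>y. u \<frown> inf_image y)"
      by (intro continuous_map_wordI[of UNIV, unfolded subtopology_UNIV] exI ballI impI)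
  qed
  then have "closedin word_topology ?K" using fin by (intro closedin_Union) auto
  moreover have "(shift ^^ k) w \<in> ?K" for k
  proof -
    obtain u j where "u \<in> image_suffixes f" "(shift ^^ k) w = u \<frown> inf_image ((shift ^^ j) w)"
      using shift_pow_inf_image[of k w] unfolding fixed by blast
    then show ?thesis using shift_pow_in_orbit_closure[of j w] by blast
  qed
  ultimately have "?X \<subseteq> ?K"
    unfolding orbit_closure_def by (intro closure_of_minimal) auto
  then show ?thesis using x by blast
qed

end

section \<open>Suffix codes\<close>

context nonerasing_morphism
begin

text \<open>
  Reading from the right, the last letters of \<open>p\<close> and \<open>p'\<close> agree, since of two suffixes of the same
  word one is a suffix of the other.  The delicate point is the left end: once \<open>p\<close> is used up, \<open>u\<close>
  could a priori be longer than \<open>u'\<close> and end with the image of a letter \<open>b\<close> of \<open>p'\<close>.  But \<open>u\<close> is a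
  suffix of some \<open>f(a)\<close>, so \<open>b = a\<close>, which leaves no letter for \<open>u'\<close>.
\<close>
lemma suffix_code_unique:
  assumes code: "suffix_code_images f"
    and "u \<in> image_suffixes f" and "u' \<in> image_suffixes f" and "u @ f p = u' @ f p'"
  shows "u = u' \<and> p = p'"
proof -
  have no_tail: "p = []" if eq: "u = u' @ f p" and u: "u \<in> image_suffixes f"
    and u': "u' \<in> image_suffixes f" for u u' p
  proof (rule ccontr)
    assume "p \<noteq> []"
    then obtain q b where p: "p = q @ [b]" by (metis rev_exhaust)
    obtain a where a: "Sublist.suffix u (f [a])" using u by (auto simp: image_suffixes_def)
    have u_eq: "u = (u' @ f q) @ f [b]" using eq by (simp add: p hom_append)
    then have "Sublist.suffix (f [b]) (f [a])" using a suffix_order.trans[OF suffixI[OF u_eq]] by blast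
    then have "b = a" using code by (auto simp: suffix_code_images_def)
    then have "u' @ f q = []" using suffix_length_le[OF a] u_eq by simp
    then show False using u' by (simp add: image_suffixes_def)
  qed
  show ?thesis
    using assms(4)
  proof (induction p arbitrary: p' rule: rev_induct)
    case Nil
    then have "p' = []" using no_tail[of u u' p'] assms(2,3) by simp
    with Nil show ?case by simp
  next
    case (snoc b p)
    show ?case
    proof (cases p' rule: rev_cases)
      case Nil
      then show ?thesis using no_tail[of u' u "p @ [b]"] assms(2,3) snoc.prems by simp
    next
      case (snoc p'' b')
      have eq: "(u @ f p) @ f [b] = (u' @ f p'') @ f [b']"
        using snoc.prems by (simp add: snoc hom_append)
      then have "Sublist.suffix (f [b]) (f [b']) \<or> Sublist.suffix (f [b']) (f [b])"
        using suffix_same_cases[OF suffixI suffixI] by metis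
      then have "b = b'" using code unfolding suffix_code_images_def by metis
      with eq snoc.IH[of p''] show ?thesis by (simp add: snoc)
    qed
  qed
qed

lemma suffix_code_injective:
  assumes "suffix_code_images f" and "f p = f p'"
  shows "p = p'"
proof -
  note letter = image_suffixes_map_letter[of undefined]
  show ?thesis using suffix_code_unique[OF assms(1) letter letter, of p p'] assms(2) by simp
qed

end

section \<open>Recognizability\<close>

lemma conc_eq_conc_split:
  assumes eq: "u \<frown> x = v \<frown> y" and "length v \<le> length u"
  obtains r where "u = v @ r" and "y = r \<frown> x"
proof
  have "take (length v) u = v"
    using arg_cong[OF eq, of "prefix (length v)"] assms(2) by simp
  then show "u = v @ drop (length v) u" by (metis append_take_drop_id)
  show "y = drop (length v) u \<frown> x"
    using arg_cong[OF eq, of "suffix (length v)"] assms(2) by simp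
qed

locale recognizable_substitution = suffix_coding f c
  for f :: "'a::finite list \<Rightarrow> 'a list" and c +
  fixes \<alpha> :: 'a
  assumes prolongable: "prolongable f \<alpha>"
    and circular: "circular_on f (factors (fixed_word f \<alpha>))"
    and suffix_code: "suffix_code_images f"
    and growing: "growing f a"
begin

abbreviation X :: "(nat \<Rightarrow> 'a) set" where "X \<equiv> orbit_closure (fixed_word f \<alpha>)"

abbreviation L :: "'a list set" where "L \<equiv> factors (fixed_word f \<alpha>)"

text \<open>
  The blocks \<open>f\<^sup>i(c(t\<^sub>i))\<close> of \<open>\<pi>(t)\<close>, \<open>t = T s\<close>, start with \<open>f\<^sup>i(b)\<close> for some letter \<open>b\<close>, but \<open>b\<close> may
  be foreign to the language: only the image of the block under \<open>f\<close> is known to occur in an element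
  of \<open>\<X>\<close>.  By the pigeonhole principle the same \<open>b\<close> occurs for infinitely many \<open>i\<close>.  If \<open>i\<^sub>0\<close> is one of
  these, the first letter \<open>a\<close> of \<open>f\<^bsup>i\<^sub>0+1\<^esup>(b)\<close> is in the language, and for larger \<open>i\<close> the word \<open>f\<^sup>i(b)\<close>
  starts with \<open>f\<^sup>j(a)\<close> where \<open>j = i - (i\<^sub>0 + 1)\<close>.
\<close>
lemma deep_blocks:
  assumes s: "s \<in> coded" and x: "proj s \<in> X"
  shows "\<exists>q j a z. proj (shift s) = (q @ (f ^^ j) [a]) \<frown> z \<and> K \<le> length q \<and> [a] \<in> L
    \<and> l \<le> length ((f ^^ Suc j) [a])"
proof -
  let ?t = "shift s"
  have t: "?t \<in> coded" by (rule shift_coded[OF s])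
  have first_letter: "(f ^^ n) (d # v) = (f ^^ n) [d] @ (f ^^ n) v" for n d v
    by (rule nonerasing_morphism.hom_Cons[OF nonerasing_morphism_pow])
  obtain i0 where inf: "infinite {i. hd (c (?t i)) = hd (c (?t i0))}"
    using pigeonhole_infinite[of "UNIV :: nat set" "\<lambda>i. hd (c (?t i))"] by auto
  define b where "b = hd (c (?t i0))"
  obtain a v where av: "(f ^^ Suc i0) [b] = a # v"
    using nonerasing_morphism.nonerasing[OF nonerasing_morphism_pow, of "Suc i0" b] by (meson neq_Nil_conv)
  have block: "c (?t i) = b # tl (c (?t i))" if "hd (c (?t i)) = b" for i
    using that decode_nonempty[OF t, of i] by (cases "c (?t i)") auto
  have "[a] \<in> factors (proj s)"
  proof -
    have "(f ^^ Suc i0) (c (s (Suc i0))) = [a] @ v @ (f ^^ Suc i0) (tl (c (?t i0)))"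
      using block[of i0] first_letter[of "Suc i0" b "tl (c (?t i0))"] av
      by (simp add: b_def shift_def del: funpow.simps)
    moreover have "(f ^^ Suc i0) (c (s (Suc i0))) \<in> factors (proj s)"
      by (rule block_in_factors[OF s])
    ultimately have "[] @ [a] @ (v @ (f ^^ Suc i0) (tl (c (?t i0)))) \<in> factors (proj s)"
      by (simp del: funpow.simps)
    then show ?thesis by (rule factors_factor)
  qed
  then have "[a] \<in> L" using factors_orbit_closure[OF x] by blast
  \<comment> \<open>This bound is uniform in \<open>i\<close> because \<open>a\<close> is fixed before \<open>i\<close> is chosen.\<close>
  obtain N where N: "\<And>n. N \<le> n \<Longrightarrow> l \<le> length ((f ^^ n) [a])"
    using growing[of a] unfolding growing_def filterlim_at_top eventually_sequentially by blast
  obtain i where i: "i \<ge> Suc i0 + N + K" "hd (c (?t i)) = b"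
    using inf unfolding infinite_nat_iff_unbounded_le b_def by blast
  define j where "j = i - Suc i0"
  have ij: "i = j + Suc i0" using i(1) by (simp add: j_def)
  let ?q = "concat (map (\<lambda>i. (f ^^ i) (c (?t i))) [0..<i])"
  have "(f ^^ i) (c (?t i)) = (f ^^ j) ((f ^^ Suc i0) [b]) @ (f ^^ i) (tl (c (?t i)))"
    using block[OF i(2)] first_letter[of i b "tl (c (?t i))"] unfolding ij funpow_add by simp
  also have "\<dots> = (f ^^ j) [a] @ (f ^^ j) v @ (f ^^ i) (tl (c (?t i)))"
    unfolding av first_letter[of j a v] by simp
  finally have "proj ?t = (?q @ (f ^^ j) [a]) \<frown> ((f ^^ j) v @ (f ^^ i) (tl (c (?t i)))) \<frown>
      inf_concat (\<lambda>k. (f ^^ (Suc i + k)) (c (?t (Suc i + k))))"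
    unfolding proj_split[OF t, of "Suc i"] by simp
  moreover have "K \<le> length ?q"
    using length_concat_nonempty[of "\<lambda>i. (f ^^ i) (c (?t i))" i] block_nonempty[OF t] i(1) by simp
  moreover have "l \<le> length ((f ^^ Suc j) [a])" using i(1) ij by (intro N) simp
  ultimately show ?thesis using \<open>[a] \<in> L\<close> by blast
qed

text \<open>
  Write \<open>p = f\<^sup>j(a)\<close> for a block as in the previous lemma and \<open>f(p) = w\<^sub>1 w\<^sub>2\<close> for the cut given by
  circularity.  The cut is used twice.  With empty context it is a boundary in
  \<open>f(p)\<close>, hence in the factorization of \<open>x\<close> given by \<open>y\<close>.  With the context in which
  \<open>f(p)\<close> occurs inside \<open>F(y')\<close> it is a boundary in the factorization given by \<open>y'\<close>; let
  \<open>v\<^sub>1\<close> be the part of \<open>F(y')\<close> before \<open>f(p)\<close>.  Injectivity of \<open>f\<close>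
  on all words identifies the words \<open>w\<^sub>1\<close> and \<open>v\<^sub>1 w\<^sub>1\<close> as images of prefixes of \<open>p\<close> and of \<open>y'\<close>.
\<close>
lemma common_cuts:
  assumes s: "s \<in> coded" and x: "proj s \<in> X" and y': "y' \<in> X"
    and eq: "proj s = u' \<frown> inf_image y'"
  shows "\<exists>m\<ge>K. \<exists>m'. c (s 0) @ f (prefix m (proj (shift s))) = u' @ f (prefix m' y')"
proof -
  obtain l where l: "\<And>w. w \<in> L \<Longrightarrow> length w \<ge> l \<Longrightarrow>
      \<exists>w1 w2. w = w1 @ w2 \<and> (\<forall>v1 v2. v1 @ w @ v2 \<in> f ` L \<longrightarrow> v1 @ w1 \<in> f ` L \<and> w2 @ v2 \<in> f ` L)"
    using circular unfolding circular_on_def by blast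
  \<comment> \<open>The block is taken beyond \<open>u'\<close>, so that it lies inside \<open>F(y')\<close>.\<close>
  obtain q j a z where yz: "proj (shift s) = (q @ (f ^^ j) [a]) \<frown> z"
    and q: "K + length u' \<le> length q" and a: "[a] \<in> L" and j: "l \<le> length ((f ^^ Suc j) [a])"
    using deep_blocks[OF s x] by blast
  define p where "p = (f ^^ j) [a]"
  have p: "p \<in> L" unfolding p_def by (rule factors_fixed_word_closed[OF prolongable a])
  have fp: "f p = (f ^^ Suc j) [a]" by (simp add: p_def)
  have "f p \<in> L" unfolding fp by (rule factors_fixed_word_closed[OF prolongable a])
  then obtain w1 w2 where w: "f p = w1 @ w2"
    and cut: "\<And>v1 v2. v1 @ f p @ v2 \<in> f ` L \<Longrightarrow> v1 @ w1 \<in> f ` L \<and> w2 @ v2 \<in> f ` L"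
    using l[of "f p"] j unfolding fp by blast
  have "[] @ f p @ [] \<in> f ` L" using p by simp
  from cut[OF this] obtain p1 p2 where p12: "w1 = f p1" "w2 = f p2" by auto
  have p_eq: "p = p1 @ p2" by (rule suffix_code_injective[OF suffix_code]) (simp add: w p12 hom_append)
  have "(c (s 0) @ f q) \<frown> (f p \<frown> inf_image z) = u' \<frown> inf_image y'"
    using eq unfolding proj_Suc[OF s] yz p_def[symmetric] by (simp add: inf_image_conc hom_append)
  moreover have "length u' \<le> length (c (s 0) @ f q)" using q length_le_length_hom[of q] by simp
  ultimately obtain v1 where v1: "c (s 0) @ f q = u' @ v1" "inf_image y' = v1 \<frown> f p \<frown> inf_image z"
    by (rule conc_eq_conc_split)
  \<comment> \<open>A prefix of \<open>y'\<close> of this length has an image that covers \<open>v\<^sub>1 f(p)\<close>, as \<open>f\<close> does not shorten words.\<close>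
  define n where "n = length (v1 @ f p)"
  have "f (prefix n y') \<frown> inf_image (suffix n y') = (v1 @ f p) \<frown> inf_image z"
    using v1(2) inf_image_conc[of "prefix n y'" "suffix n y'"] by simp
  moreover have "length (v1 @ f p) \<le> length (f (prefix n y'))"
    using length_le_length_hom[of "prefix n y'"] by (simp add: n_def)
  ultimately obtain v2 where v2: "f (prefix n y') = (v1 @ f p) @ v2" by (rule conc_eq_conc_split)
  have "prefix n y' \<in> L" using y' unfolding orbit_closure_iff by blast
  then have "v1 @ f p @ v2 \<in> f ` L" using v2 by (metis append_assoc imageI)
  from cut[OF this] obtain q1 q2 where q12: "v1 @ w1 = f q1" "w2 @ v2 = f q2" by auto
  have "f (prefix n y') = f (q1 @ q2)" using v2 q12 by (simp add: w hom_append)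
  then have "prefix n y' = q1 @ q2" by (rule suffix_code_injective[OF suffix_code])
  from arg_cong[OF this, of "take (length q1)"] arg_cong[OF this, of length]
  have q1: "prefix (length q1) y' = q1" by simp
  have "proj (shift s) = (q @ p1) \<frown> p2 \<frown> z" unfolding yz p_def[symmetric] p_eq by simp
  then have qp: "prefix (length (q @ p1)) (proj (shift s)) = q @ p1"
    by (simp only: prefix_conc_length)
  have "c (s 0) @ f (q @ p1) = u' @ f q1"
    using v1(1) q12(1) p12(1) by (metis hom_append append_assoc)
  moreover have "K \<le> length (q @ p1)" using q by simp
  ultimately show ?thesis using q1 qp by metis
qed

text \<open>
  Up to each common boundary the two factorizations agree by the suffix code property, and common
  boundaries exist beyond every position.
\<close>
lemma desubstitution_unique:
  assumes s: "s \<in> coded" and x: "proj s \<in> X" and u': "u' \<in> image_suffixes f" and y': "y' \<in> X"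
    and eq: "proj s = u' \<frown> inf_image y'"
  shows "c (s 0) = u'" and "proj (shift s) = y'"
proof -
  have "c (s 0) = u' \<and> (\<exists>m\<ge>K. prefix m (proj (shift s)) = prefix m y')" for K
  proof -
    obtain m m' where m: "K \<le> m" "c (s 0) @ f (prefix m (proj (shift s))) = u' @ f (prefix m' y')"
      using common_cuts[OF s x y' eq] by blast
    from suffix_code_unique[OF suffix_code decode[OF s] u' m(2)]
    have "c (s 0) = u'" "prefix m (proj (shift s)) = prefix m' y'" by auto
    moreover from arg_cong[OF this(2), of length] have "m = m'" by simp
    ultimately show ?thesis using m(1) by blast
  qed
  note * = this
  show "c (s 0) = u'" using *[of 0] by blast
  show "proj (shift s) = y'"
  proof
    fix i
    show "proj (shift s) i = y' i" using *[of "Suc i"] unfolding prefix_eq_iff by auto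
  qed
qed

abbreviation coding_space :: "(nat \<Rightarrow> nat) set" where
  "coding_space \<equiv> suffix_space f \<alpha> c"

lemma space_iff: "s \<in> coding_space \<longleftrightarrow> s \<in> coded \<and> proj s \<in> X"
  by (simp add: suffix_space_def)

lemma desubstitution:
  assumes "x \<in> X"
  shows "\<exists>u\<in>image_suffixes f. \<exists>y\<in>X. x = u \<frown> inf_image y"
  using assms
  by (intro desubstitution_exists finite_image_suffixes inf_image_fixed_word prolongable
      compactin_orbit_closure)

text \<open>
  Comparison with a desubstitution inside the orbit closure shows that \<open>\<pi>(T s)\<close> lies in \<open>\<X>\<close>, which
  the definition of the space of code words does not provide.
\<close>
lemma shift_space:
  assumes "s \<in> coding_space"
  shows "shift s \<in> coding_space"
proof -
  have s: "s \<in> coded" "proj s \<in> X" using assms by (auto simp: space_iff)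
  obtain u y where "u \<in> image_suffixes f" "y \<in> X" "proj s = u \<frown> inf_image y"
    using desubstitution[OF s(2)] by blast
  then have "proj (shift s) = y" using desubstitution_unique(2)[OF s] by blast
  then show ?thesis using \<open>y \<in> X\<close> shift_coded[OF s(1)] by (simp add: space_iff)
qed

lemma inj_on_proj: "inj_on proj coding_space"
proof (rule inj_onI)
  have "s n = t n" if "s \<in> coding_space" "t \<in> coding_space" "proj s = proj t" for s t n
    using that
  proof (induction n arbitrary: s t)
    case (0 s t)
    then show ?case
      using desubstitution_unique(1)[of s "c (t 0)" "proj (shift t)"] shift_space[of t]
        proj_Suc[of t] decode[of t 0] decode_inj[of s t 0] by (simp add: space_iff)
  next
    case (Suc n s t)
    then have "proj (shift s) = proj (shift t)"
      using desubstitution_unique(2)[of s "c (t 0)" "proj (shift t)"] shift_space[of t]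
        proj_Suc[of t] decode[of t 0] by (simp add: space_iff)
    then have "shift s n = shift t n" using Suc.IH shift_space Suc.prems(1,2) by blast
    then show ?case by (simp add: shift_def)
  qed
  then show "s = t" if "s \<in> coding_space" "t \<in> coding_space" "proj s = proj t" for s t
    using that by blast
qed

lemma proj_surj:
  assumes x: "x \<in> X"
  shows "x \<in> proj ` coding_space"
proof -
  have "\<exists>p. fst p \<in> image_suffixes f \<and> snd p \<in> X \<and> y = fst p \<frown> inf_image (snd p)"
    if y: "y \<in> X" for y
  proof -
    obtain u z where "u \<in> image_suffixes f" "z \<in> X" "y = u \<frown> inf_image z"
      using desubstitution[OF y] by blast
    then show ?thesis by (intro exI[of _ "(u, z)"]) simp
  qed
  then have "\<exists>P. \<forall>y\<in>X. fst (P y) \<in> image_suffixes f \<and> snd (P y) \<in> X \<and>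
      y = fst (P y) \<frown> inf_image (snd (P y))"
    by (intro bchoice ballI)
  then obtain P where P: "\<forall>y\<in>X. fst (P y) \<in> image_suffixes f \<and> snd (P y) \<in> X \<and>
      y = fst (P y) \<frown> inf_image (snd (P y))" ..
  \<comment> \<open>\<open>D y\<close> is the suffix removed from \<open>y\<close> and \<open>E y\<close> the desubstituted rest.\<close>
  define D where "D = (\<lambda>y. fst (P y))"
  define E where "E = (\<lambda>y. snd (P y))"
  have D: "D y \<in> image_suffixes f" and E: "E y \<in> X" and DE: "y = D y \<frown> inf_image (E y)"
    if "y \<in> X" for y
    unfolding D_def E_def using bspec[OF P that] by blast+
  have En: "(E ^^ n) x \<in> X" for n by (induction n) (simp_all add: x E)
  define s where "s = (\<lambda>n. encode (D ((E ^^ n) x)))"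
  have s: "s \<in> coded" unfolding s_def by (simp add: encode_in_alphabet D En)
  have cs: "c (s n) = D ((E ^^ n) x)" for n by (simp add: s_def decode_encode D En)
  have pow: "(inf_image ^^ n) (u \<frown> y) = (f ^^ n) u \<frown> (inf_image ^^ n) y" for n u y
    by (induction n) (auto simp: inf_image_conc)
  let ?Z = "\<lambda>n. (inf_image ^^ n) ((E ^^ n) x)"
  have step: "?Z n = (f ^^ n) (c (s n)) \<frown> ?Z (Suc n)" for n
  proof -
    have "?Z n = (inf_image ^^ n) (c (s n) \<frown> inf_image ((E ^^ Suc n) x))"
      unfolding cs funpow.simps(2) o_apply by (rule arg_cong[OF DE[OF En]])
    also have "\<dots> = (f ^^ n) (c (s n)) \<frown> ?Z (Suc n)"
      unfolding pow by (simp add: funpow_swap1)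
    finally show ?thesis .
  qed
  have "?Z 0 = proj s"
    unfolding proj_eq by (rule inf_concat_eqI[where Z = ?Z]) (rule block_nonempty[OF s], rule step)
  then have "x = proj s" by simp
  moreover from this have "s \<in> coding_space" using s x by (simp add: space_iff)
  ultimately show ?thesis by (rule image_eqI)
qed

lemma homeomorphic_map_proj:
  "homeomorphic_map (subtopology word_topology coding_space) (subtopology word_topology X) proj"
proof (rule continuous_imp_homeomorphic_map)
  have cont: "continuous_map (subtopology word_topology Y) word_topology proj" if "Y \<subseteq> coded" for Y
    using that by (intro continuous_map_wordI exI ballI impI prefix_proj_cong) blast+
  have sub: "coding_space \<subseteq> coded" by (auto simp: space_iff)
  have image: "proj ` coding_space = X"
    using proj_surj by (auto simp: space_iff)
  show "continuous_map (subtopology word_topology coding_space) (subtopology word_topology X) proj"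
    using cont[OF sub] by (auto simp: continuous_map_in_subtopology space_iff)
  have "compactin word_topology coded"
    by (rule compactin_words_over) (simp add: suffix_alphabet_def)
  moreover have "closedin (subtopology word_topology coded) {s \<in> coded. proj s \<in> X}"
    using closedin_continuous_map_preimage[OF cont[OF order_refl] closedin_orbit_closure] by simp
  ultimately have "compactin (subtopology word_topology coded) {s \<in> coded. proj s \<in> X}"
    by (intro closedin_compact_space) (simp_all add: compact_space_subtopology)
  moreover have "{s \<in> coded. proj s \<in> X} = coding_space" by (auto simp: space_iff)
  ultimately show "compact_space (subtopology word_topology coding_space)"
    by (simp add: compactin_subtopology compact_space_subtopology)
  show "Hausdorff_space (subtopology word_topology X)"
    by (intro Hausdorff_space_subtopology Hausdorff_word_topology)
  show "proj ` topspace (subtopology word_topology coding_space) = topspace (subtopology word_topology X)"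
    using image by simp
  show "inj_on proj (topspace (subtopology word_topology coding_space))"
    using inj_on_proj by simp
qed

lemma H_space: "s \<in> coding_space \<Longrightarrow> H_map f c s \<in> coding_space"
  unfolding space_iff using H_coded[of s] proj_H[of s] shift_orbit_closure[of "proj s"] by simp

end

theorem theorem1:
  fixes f :: "'a::finite list \<Rightarrow> 'a list" and \<alpha> :: 'a and c :: "nat \<Rightarrow> 'a list"
  assumes "morphism f"
    and "prolongable f \<alpha>"
    and "bij_betw c (suffix_alphabet f) (image_suffixes f)"
    and "circular_on f (factors (fixed_word f \<alpha>))"
    and "suffix_code_images f"
    and "\<forall>a. growing f a"
  shows "H_map f c \<in> suffix_space f \<alpha> c \<rightarrow> suffix_space f \<alpha> c
    \<and> (\<forall>s\<in>suffix_space f \<alpha> c. suffix_proj f c (H_map f c s) = shift (suffix_proj f c s))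
    \<and> conjugacy (suffix_space f \<alpha> c) (H_map f c) (orbit_closure (fixed_word f \<alpha>)) shift (suffix_proj f c)"
proof -
  interpret recognizable_substitution f c \<alpha>
  proof
    show hom: "f (u @ v) = f u @ f v" for u v using assms(1) by (simp add: morphism_def)
    show "f [a] \<noteq> []" for a
    proof
      assume "f [a] = []"
      moreover have "f [] = []" using hom[of "[]" "[]"] by simp
      ultimately have "(f ^^ Suc n) [a] = []" for n by (induction n) auto
      moreover obtain N where "\<And>n. N \<le> n \<Longrightarrow> 1 \<le> length ((f ^^ n) [a])"
        using assms(6) unfolding growing_def filterlim_at_top eventually_sequentially by blast
      ultimately show False by (metis le_SucI list.size(3) not_one_le_zero order_refl)
    qed
  qed (use assms in auto)
  have "H_map f c \<in> coding_space \<rightarrow> coding_space" using H_space by blast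
  moreover have "\<forall>s\<in>coding_space. proj (H_map f c s) = shift (proj s)"
    using proj_H by (simp add: space_iff)
  moreover have "shift \<in> X \<rightarrow> X" using shift_orbit_closure by blast
  ultimately show ?thesis unfolding conjugacy_def using homeomorphic_map_proj by blast
qed

end
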